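(* Let $A$ and $B$ be unital complex Banach algebras, and let $\mathfrak{A}$ and $\mathfrak{B}$ be open subgroups of $A^{-1}$ and $B^{-1}$ respectively. Suppose that $T:\mathfrak{A}\to\mathfrak{B}$ is an isometrical isomorphism of metrizable groups, i.e. a group isomorphism of $\mathfrak{A}$ onto $\mathfrak{B}$ with $\|T(a)-T(b)\|=\|a-b\|$ for all $a,b\in\mathfrak{A}$. Then $T$ extends to an isometrical real-algebra isomorphism from $A$ onto $B$ (a bijective, real-linear, multiplicative isometry $A\to B$). In particular, $A^{-1}$ is isometrically isomorphic to $B^{-1}$ as a metrizable group.
   Context: $A^{-1}$ denotes the multiplicative group of all invertible elements of a unital Banach algebra $A$, with the metric induced by the norm. Two such groups (or subgroups) are isometrically isomorphic as metrizable groups if there is a group isomorphism from one onto the other that preserves the norm distance. Unital Banach algebras are complex, have submultiplicative norm, and the unit has norm $1$. *)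

theory Defs
  imports "HOL-Analysis.Analysis" "HOL-Algebra.Group"
begin

(* The library only provides real normed algebras.  norm_one, and hence 0 \<noteq> 1, is
   inherited from real_normed_algebra_1, completeness from banach; scaleR_scaleC identifies
   the underlying real structure with the restriction of the complex scalar multiplication. *)
class complex_banach_algebra_1 = real_normed_algebra_1 + banach +
  fixes scaleC :: "complex \<Rightarrow> 'a \<Rightarrow> 'a"  (infixr "*\<^sub>C" 75)
  assumes scaleC_add_right: "c *\<^sub>C (x + y) = c *\<^sub>C x + c *\<^sub>C y"
    and scaleC_add_left: "(c + d) *\<^sub>C x = c *\<^sub>C x + d *\<^sub>C x"
    and scaleC_scaleC: "c *\<^sub>C d *\<^sub>C x = (c * d) *\<^sub>C x"
    and scaleC_one: "1 *\<^sub>C x = x"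
    and mult_scaleC_left: "c *\<^sub>C x * y = c *\<^sub>C (x * y)"
    and mult_scaleC_right: "x * c *\<^sub>C y = c *\<^sub>C (x * y)"
    and norm_scaleC: "norm (c *\<^sub>C x) = cmod c * norm x"
    and scaleR_scaleC: "r *\<^sub>R x = complex_of_real r *\<^sub>C x"

instantiation complex :: complex_banach_algebra_1
begin
definition scaleC_complex :: "complex \<Rightarrow> complex \<Rightarrow> complex"
  where "scaleC_complex c x = c * x"
instance
  by standard
    (simp_all add: scaleC_complex_def algebra_simps norm_mult scaleR_conv_of_real)
end

definition invertible_group :: "'a::monoid_mult monoid"
  where "invertible_group = units_of \<lparr>carrier = UNIV, mult = (*), one = 1\<rparr>"

lemma carrier_invertible_group:
  "carrier invertible_group = {x. \<exists>y. y * x = 1 \<and> x * y = 1}"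
  by (simp add: invertible_group_def units_of_def Units_def)

definition isometric_group_iso ::
  "'a::real_normed_vector monoid \<Rightarrow> 'b::real_normed_vector monoid \<Rightarrow> ('a \<Rightarrow> 'b) \<Rightarrow> bool"
  where "isometric_group_iso G H h \<longleftrightarrow>
    h \<in> iso G H \<and>
    (\<forall>a\<in>carrier G. \<forall>b\<in>carrier G. norm (h a - h b) = norm (a - b))"

definition isometric_real_algebra_iso ::
  "('a::real_normed_algebra_1 \<Rightarrow> 'b::real_normed_algebra_1) \<Rightarrow> bool"
  where "isometric_real_algebra_iso S \<longleftrightarrow>
    bij S \<and> linear S \<and>
    (\<forall>x y. S (x * y) = S x * S y) \<and>
    (\<forall>x y. norm (S x - S y) = norm (x - y))"

end

theory Submission
  imports Defs
begin

text \<open>The proof determines \<open>T\<close> first near \<open>1\<close> and then on the whole group.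

The invertible elements fill a ball around \<open>1\<close> and each subgroup is open among them, so both
subgroups contain a ball around \<open>1\<close>, and \<open>T\<close> restricts to a surjective isometry between balls. A local version of the Mazur--Ulam theorem
(\<open>local_isometry_midpoint\<close>) shows that \<open>T\<close> preserves midpoints near \<open>1\<close>. Hence
\<open>T (1 + x) = 1 + S x\<close> for small \<open>x\<close>, with \<open>S\<close> a real-linear isometry of the whole algebra
(\<open>midpoint_isometry_extends_linear\<close>). Multiplicativity of \<open>T\<close> near \<open>1\<close> passes to \<open>S\<close>, and
surjectivity of \<open>S\<close> gives \<open>S 1 = 1\<close>; so \<open>S\<close> is an isometric algebra isomorphism that agrees with
\<open>T\<close> near \<open>1\<close> (\<open>local_isometric_hom_is_algebra_iso\<close>).

The subgroup may be disconnected, so \<open>S = T\<close> near \<open>1\<close> does not by algebra alone give \<open>S = T\<close>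
everywhere. Here the metric enters a second time. For \<open>g\<close> in the group put \<open>w = g - g'\<close> where
\<open>S g' = T g\<close>. Comparing the distances of \<open>T g\<close> to the images of the elements \<open>g' - \<mu>\<close>, with \<open>\<mu>\<close>
a large complex scalar, yields \<open>norm (w + \<mu>) = cmod \<mu>\<close> for all such \<open>\<mu>\<close>. In a complex normed
algebra only \<open>w = 0\<close> has this property (\<open>norm_one_plus_circle_le_one_imp_zero\<close>), by Cauchy's
estimate applied to the powers of \<open>1 + z w\<close>.\<close>

section \<open>A local Mazur--Ulam theorem\<close>

text \<open>Compose an isometry \<open>h\<close> of \<open>W\<close>, the reflection \<open>\<psi>\<close> in \<open>z\<close>, the inverse of \<open>h\<close>, and \<open>\<psi>\<close>
again: the resulting isometry of \<open>W\<close> moves \<open>z\<close> exactly twice as far as \<open>h\<close> does. Iteration would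
move \<open>z\<close> arbitrarily far inside a bounded set, unless the displacement is zero. This is
Vaisala's argument for the Mazur--Ulam theorem.\<close>

lemma isometry_fixes_symmetry_centre:
  fixes W :: "'a::real_normed_vector set"
  assumes "bounded W" "z \<in> W" and sym: "\<And>w. w \<in> W \<Longrightarrow> 2 *\<^sub>R z - w \<in> W"
    and "bij_betw g W W" and "\<And>x y. x \<in> W \<Longrightarrow> y \<in> W \<Longrightarrow> norm (g x - g y) = norm (x - y)"
  shows "g z = z"
proof -
  obtain M where M: "\<And>w. w \<in> W \<Longrightarrow> norm w \<le> M"
    using \<open>bounded W\<close> by (auto simp: bounded_iff)
  have iter: "\<exists>h. bij_betw h W W \<and> (\<forall>x\<in>W. \<forall>y\<in>W. norm (h x - h y) = norm (x - y))
          \<and> norm (h z - z) = 2 ^ n * norm (g z - z)" for n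
  proof (induction n)
    case 0
    then show ?case using assms(4,5) by (intro exI[of _ g]) simp
  next
    case (Suc n)
    then obtain h where h: "bij_betw h W W"
        "\<And>x y. x \<in> W \<Longrightarrow> y \<in> W \<Longrightarrow> norm (h x - h y) = norm (x - y)"
        "norm (h z - z) = 2 ^ n * norm (g z - z)"
      by blast
    define k where "k = inv_into W h"
    define \<psi> where "\<psi> w = 2 *\<^sub>R z - w" for w
    have k: "bij_betw k W W" and hk: "\<And>w. w \<in> W \<Longrightarrow> h (k w) = w" and kh: "\<And>w. w \<in> W \<Longrightarrow> k (h w) = w"
      using h(1) by (auto simp: k_def bij_betw_inv_into bij_betw_inv_into_left bij_betw_inv_into_right)
    have kW: "k w \<in> W" and hW: "h w \<in> W" if "w \<in> W" for w
      using k h(1) that by (auto simp: bij_betw_def)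
    have kn: "norm (k x - k y) = norm (x - y)" if "x \<in> W" "y \<in> W" for x y
      using h(2)[of "k x" "k y"] that by (simp add: hk kW)
    have \<psi>W: "\<psi> w \<in> W" if "w \<in> W" for w using sym that by (simp add: \<psi>_def)
    have \<psi>\<psi>: "\<psi> (\<psi> w) = w" for w by (simp add: \<psi>_def)
    have \<psi>: "bij_betw \<psi> W W"
      by (rule bij_betwI[of _ _ _ \<psi>]) (auto simp: \<psi>W \<psi>\<psi>)
    have \<psi>n: "norm (\<psi> x - \<psi> y) = norm (x - y)" for x y
      by (simp add: \<psi>_def norm_minus_commute)
    \<comment> \<open>one doubling step: \<open>f\<close> moves \<open>z\<close> twice as far as \<open>h\<close>\<close>
    define f where "f = \<psi> \<circ> (k \<circ> (\<psi> \<circ> h))"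
    have "bij_betw f W W"
      unfolding f_def by (intro bij_betw_trans[OF _ \<psi>] bij_betw_trans[OF _ k] bij_betw_trans[OF h(1) \<psi>])
    moreover have "norm (f x - f y) = norm (x - y)" if "x \<in> W" "y \<in> W" for x y
      using that by (simp add: f_def \<psi>n kn hW \<psi>W h(2))
    moreover have "norm (f z - z) = 2 ^ Suc n * norm (g z - z)"
    proof -
      have "\<psi> z = z" by (simp add: \<psi>_def scaleR_2)
      then have "norm (f z - z) = norm (k (\<psi> (h z)) - k (h z))"
        using \<psi>n[of "k (\<psi> (h z))" z] kh[OF \<open>z \<in> W\<close>] by (simp add: f_def)
      also have "\<dots> = norm (\<psi> (h z) - h z)"
        using \<open>z \<in> W\<close> by (simp add: kn hW \<psi>W)
      also have "\<psi> (h z) - h z = (-2) *\<^sub>R (h z - z)"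
        by (simp add: \<psi>_def algebra_simps scaleR_2)
      finally show ?thesis using h(3) by simp
    qed
    ultimately show ?case by blast
  qed
  have *: "2 ^ n * norm (g z - z) \<le> 2 * M" for n
  proof -
    obtain h where h: "bij_betw h W W" "norm (h z - z) = 2 ^ n * norm (g z - z)"
      using iter by blast
    have "h z \<in> W" using h(1) \<open>z \<in> W\<close> by (auto simp: bij_betw_def)
    then show ?thesis
      using h(2) M[of z] M[of "h z"] \<open>z \<in> W\<close> norm_triangle_ineq4[of "h z" z] by linarith
  qed
  show ?thesis
  proof (rule ccontr)
    assume "g z \<noteq> z"
    then have "norm (g z - z) > 0" by simp
    moreover obtain n where "2 * M / norm (g z - z) < 2 ^ n"
      using real_arch_pow[of 2] by auto
    ultimately show False using *[of n] by (simp add: field_simps)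
  qed
qed

text \<open>Carrying the reflection of \<open>W'\<close> back along \<open>T\<close> gives an isometry of \<open>W\<close>, which fixes \<open>z\<close>; so the
reflection of \<open>W'\<close> fixes \<open>T z\<close>, and its only fixed point is \<open>z'\<close>.\<close>

lemma isometry_maps_symmetry_centre:
  fixes T :: "'a::real_normed_vector \<Rightarrow> 'b::real_normed_vector"
  assumes "bounded W" "z \<in> W" "z' \<in> W'"
    and sym: "\<And>w. w \<in> W \<Longrightarrow> 2 *\<^sub>R z - w \<in> W"
    and sym': "\<And>w. w \<in> W' \<Longrightarrow> 2 *\<^sub>R z' - w \<in> W'"
    and T: "bij_betw T W W'"
    and iso: "\<And>x y. x \<in> W \<Longrightarrow> y \<in> W \<Longrightarrow> norm (T x - T y) = norm (x - y)"
  shows "T z = z'"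
proof -
  define k where "k = inv_into W T"
  define \<psi> where "\<psi> w = 2 *\<^sub>R z' - w" for w
  have k: "bij_betw k W' W" and Tk: "\<And>w. w \<in> W' \<Longrightarrow> T (k w) = w"
    using T by (auto simp: k_def bij_betw_inv_into bij_betw_inv_into_right)
  have kW: "w \<in> W' \<Longrightarrow> k w \<in> W" and TW: "v \<in> W \<Longrightarrow> T v \<in> W'" for v w
    using k T by (auto simp: bij_betw_def)
  have kn: "norm (k x - k y) = norm (x - y)" if "x \<in> W'" "y \<in> W'" for x y
    using iso[of "k x" "k y"] that by (simp add: Tk kW)
  have \<psi>W: "\<psi> w \<in> W'" if "w \<in> W'" for w using sym' that by (simp add: \<psi>_def)
  have \<psi>: "bij_betw \<psi> W' W'"
    by (rule bij_betwI[of _ _ _ \<psi>]) (auto simp: \<psi>W, auto simp: \<psi>_def)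
  have \<psi>n: "norm (\<psi> x - \<psi> y) = norm (x - y)" for x y
    by (simp add: \<psi>_def norm_minus_commute)
  have "(k \<circ> (\<psi> \<circ> T)) z = z"
  proof (rule isometry_fixes_symmetry_centre[OF assms(1,2) sym])
    show "bij_betw (k \<circ> (\<psi> \<circ> T)) W W"
      by (intro bij_betw_trans[OF _ k] bij_betw_trans[OF T \<psi>])
    show "norm ((k \<circ> (\<psi> \<circ> T)) x - (k \<circ> (\<psi> \<circ> T)) y) = norm (x - y)" if "x \<in> W" "y \<in> W" for x y
      using that by (simp add: kn \<psi>n TW \<psi>W iso)
  qed
  then have "\<psi> (T z) = T z"
    using Tk[OF \<psi>W[OF TW[OF \<open>z \<in> W\<close>]]] by simp
  then have "2 *\<^sub>R z' = 2 *\<^sub>R T z"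
    by (simp add: \<psi>_def algebra_simps scaleR_2)
  then show ?thesis by simp
qed

text \<open>A local Mazur--Ulam theorem. The midpoint of \<open>x\<close> and \<open>y\<close> is the centre of symmetry of the set of
points within \<open>dist x y / 2\<close> of both. This set is described by distances alone, so \<open>T\<close> maps it onto
the corresponding set for \<open>T x\<close> and \<open>T y\<close>, provided that both sets lie where \<open>T\<close> and its
inverse are defined; halving the radius of the ball ensures this.\<close>

lemma local_isometry_midpoint:
  fixes T :: "'a::real_normed_vector \<Rightarrow> 'b::real_normed_vector"
  assumes T: "bij_betw T A B"
    and iso: "\<And>x y. x \<in> A \<Longrightarrow> y \<in> A \<Longrightarrow> norm (T x - T y) = norm (x - y)"
    and A: "ball c r \<subseteq> A" and B: "ball (T c) r \<subseteq> B"
    and x: "x \<in> ball c (r/2)" and y: "y \<in> ball c (r/2)"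
  shows "T (midpoint x y) = midpoint (T x) (T y)"
proof -
  define \<rho> where "\<rho> = dist x y / 2"
  have sub: "cball u (dist u v / 2) \<subseteq> ball e r"
    if "u \<in> ball e (r/2)" "v \<in> ball e (r/2)" for u v e :: "'c::real_normed_vector"
  proof
    fix w assume "w \<in> cball u (dist u v / 2)"
    then show "w \<in> ball e r"
      using that dist_triangle[of e w u] dist_triangle[of u v e] by (auto simp: dist_commute)
  qed
  have sym: "2 *\<^sub>R midpoint u v - w \<in> cball u s \<inter> cball v s"
    if "w \<in> cball u s \<inter> cball v s" for u v w :: "'c::real_normed_vector" and s
  proof -
    have "2 *\<^sub>R midpoint u v - w = u + v - w" by (simp add: midpoint_def)
    then show ?thesis using that by (auto simp: dist_norm algebra_simps norm_minus_commute)
  qed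
  have mid: "midpoint u v \<in> cball u (dist u v / 2) \<inter> cball v (dist u v / 2)" for u v :: "'c::real_normed_vector"
    by (simp add: dist_midpoint)
  have "c \<in> ball c r"
    using x zero_le_dist[of c x] by (simp del: zero_le_dist)
  then have cA: "c \<in> A" using A by blast
  have inA: "v \<in> A" if "v \<in> ball c (r/2)" for v
  proof -
    have "v \<in> ball c r" using that zero_le_dist[of c v] by (auto simp del: zero_le_dist)
    then show ?thesis using A by blast
  qed
  have xA: "x \<in> A" and yA: "y \<in> A" using inA x y by blast+
  have Td: "dist (T u) (T v) = dist u v" if "u \<in> A" "v \<in> A" for u v
    using iso[OF that] by (simp add: dist_norm)
  define W where "W = cball x \<rho> \<inter> cball y \<rho>"
  define W' where "W' = cball (T x) \<rho> \<inter> cball (T y) \<rho>"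
  have \<rho>': "\<rho> = dist (T x) (T y) / 2"
    by (simp add: \<rho>_def Td xA yA)
  have WA: "W \<subseteq> A" using sub[OF x y] A by (auto simp: W_def \<rho>_def)
  have Tx: "T x \<in> ball (T c) (r/2)" "T y \<in> ball (T c) (r/2)"
    using x y by (simp_all add: Td cA xA yA)
  have WB: "W' \<subseteq> B" using sub[OF Tx] B by (auto simp: W'_def \<rho>')
  have bij: "bij_betw T W W'"
  proof (rule bij_betw_imageI)
    show "inj_on T W" using T WA by (meson bij_betw_def inj_on_subset)
    show "T ` W = W'"
    proof
      show "T ` W \<subseteq> W'"
        using WA by (auto simp: W_def W'_def Td xA yA)
      show "W' \<subseteq> T ` W"
      proof
        fix w assume w: "w \<in> W'"
        then obtain v where v: "v \<in> A" "w = T v"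
          using WB T by (auto simp: bij_betw_def)
        then show "w \<in> T ` W"
          using w by (auto simp: W_def W'_def Td xA yA)
      qed
    qed
  qed
  show ?thesis
  proof (rule isometry_maps_symmetry_centre[OF _ _ _ _ _ bij])
    show "bounded W" by (simp add: W_def bounded_Int)
    show "midpoint x y \<in> W" using mid[of x y] by (simp add: W_def \<rho>_def)
    show "midpoint (T x) (T y) \<in> W'" using mid[of "T x" "T y"] by (simp only: W'_def \<rho>')
    show "2 *\<^sub>R midpoint x y - w \<in> W" if "w \<in> W" for w
      using sym that unfolding W_def by blast
    show "2 *\<^sub>R midpoint (T x) (T y) - w \<in> W'" if "w \<in> W'" for w
      using sym that unfolding W'_def by blast
    show "norm (T u - T v) = norm (u - v)" if "u \<in> W" "v \<in> W" for u v
      using iso that WA by blast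
  qed
qed

section \<open>Linear extension of midpoint-preserving isometries\<close>

text \<open>The defect \<open>S (t x) - t S x\<close> is additive in \<open>t\<close> and vanishes for integers \<open>t\<close>, so it depends only on
the fractional part of \<open>t\<close> and is bounded. A bounded additive function of \<open>t\<close> is zero.\<close>

lemma additive_isometry_linear:
  fixes S :: "'a::real_normed_vector \<Rightarrow> 'b::real_normed_vector"
  assumes add: "\<And>x y. S (x + y) = S x + S y" and n: "\<And>x. norm (S x) = norm x"
  shows "linear S"
proof -
  interpret S: additive S by (rule additive.intro) (rule add)
  have S_nat: "S (real k *\<^sub>R x) = real k *\<^sub>R S x" for k x
    by (induction k) (simp_all add: S.zero S.add scaleR_left_distrib)
  have S_int: "S (of_int k *\<^sub>R x) = of_int k *\<^sub>R S x" for k :: int and x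
    by (cases k) (simp_all only: of_int_of_nat_eq of_int_minus scaleR_minus_left S.minus S_nat)
  have "S (c *\<^sub>R x) = c *\<^sub>R S x" for c x
  proof -
    define D where "D t = S (t *\<^sub>R x) - t *\<^sub>R S x" for t
    have D: "norm (D t) \<le> 2 * norm x" for t
    proof -
      have "D t = D (frac t)"
        using S_int[of "\<lfloor>t\<rfloor>" x]
        by (simp add: D_def frac_def S.diff scaleR_left_diff_distrib)
      also have "norm \<dots> \<le> frac t * norm x + frac t * norm x"
        using norm_triangle_ineq4[of "S (frac t *\<^sub>R x)" "frac t *\<^sub>R S x"]
        by (simp add: D_def n frac_ge_0)
      also have "\<dots> \<le> 1 * norm x + 1 * norm x"
        by (intro add_mono mult_right_mono) (simp_all add: less_imp_le[OF frac_lt_1])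
      finally show ?thesis by simp
    qed
    have "real k * norm (D c) \<le> 2 * norm x" for k
    proof -
      have "D (real k * c) = real k *\<^sub>R D c"
        using S_nat[of k "c *\<^sub>R x"] by (simp add: D_def scaleR_right_diff_distrib)
      then show ?thesis using D[of "real k * c"] by simp
    qed
    moreover have "\<exists>k. 2 * norm x < real k * norm (D c)" if "D c \<noteq> 0"
      using reals_Archimedean3[of "norm (D c)"] that by simp
    ultimately have "D c = 0" by (meson not_less)
    then show ?thesis by (simp add: D_def)
  qed
  then show ?thesis using add by (intro linearI) auto
qed

text \<open>Since \<open>F\<close> fixes \<open>0\<close> and respects midpoints, it commutes with halving, so \<open>2^n F (x / 2^n)\<close> has the
same value for every \<open>n\<close> with \<open>x / 2^n\<close> in the ball. This value is the extension.\<close>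

lemma midpoint_isometry_extends_linear:
  fixes F :: "'a::real_normed_vector \<Rightarrow> 'b::real_normed_vector"
  assumes "\<delta> > 0" and F0: "F 0 = 0"
    and mid: "\<And>x y. norm x < \<delta> \<Longrightarrow> norm y < \<delta> \<Longrightarrow> F (midpoint x y) = midpoint (F x) (F y)"
    and iso: "\<And>x. norm x < \<delta> \<Longrightarrow> norm (F x) = norm x"
  shows "\<exists>S. linear S \<and> (\<forall>x. norm (S x) = norm x) \<and> (\<forall>x. norm x < \<delta> \<longrightarrow> S x = F x)"
proof -
  have half: "F ((1/2) *\<^sub>R x) = (1/2) *\<^sub>R F x" if "norm x < \<delta>" for x
    using mid[of x 0] that \<open>\<delta> > 0\<close> by (simp add: F0 midpoint_def)
  have pow: "norm ((1/2^k) *\<^sub>R x) < \<delta> \<and> F ((1/2^k) *\<^sub>R x) = (1/2^k) *\<^sub>R F x" if "norm x < \<delta>" for x k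
  proof (induction k)
    case 0 then show ?case using that by simp
  next
    case (Suc k)
    have "(1/2^Suc k) *\<^sub>R x = (1/2) *\<^sub>R ((1/2^k) *\<^sub>R x)" by simp
    then show ?case using half[of "(1/2^k) *\<^sub>R x"] Suc \<open>\<delta> > 0\<close>
        order_le_less_trans[of "norm x / (2 * 2 ^ k)" "norm x / 2 ^ k" \<delta>]
      by (simp add: frac_le)
  qed
  define G where "G n x = (2^n) *\<^sub>R F ((1/2^n) *\<^sub>R x)" for n x
  have G: "G (n + k) x = G n x" if "norm x < \<delta> * 2 ^ n" for n k x
  proof -
    have "norm ((1/2^n) *\<^sub>R x) < \<delta>" using that by (simp add: field_simps)
    from pow[OF this, of k] show ?thesis
      by (simp add: G_def power_add field_simps)
  qed
  have ex: "\<exists>n. norm x < \<delta> * 2 ^ n" for x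
    using real_arch_pow[of 2 "norm x / \<delta>"] \<open>\<delta> > 0\<close> by (auto simp: field_simps)
  have shrink: "norm ((1/2^n) *\<^sub>R x) < \<delta>" if "norm x < \<delta> * 2 ^ n" for n and x :: 'a
    using that by (simp add: field_simps)
  define S where "S x = G (LEAST n. norm x < \<delta> * 2 ^ n) x" for x
  have S: "S x = G n x" if "norm x < \<delta> * 2 ^ n" for n x
  proof -
    define m where "m = (LEAST n. norm x < \<delta> * 2 ^ n)"
    have "norm x < \<delta> * 2 ^ m" "m \<le> n"
      unfolding m_def using that by (rule LeastI, rule Least_le)
    then show ?thesis using G[of x m "n - m"] by (simp add: S_def m_def)
  qed
  have add: "S (x + y) = S x + S y" for x y
  proof -
    obtain n where n: "norm x + norm y < \<delta> * 2 ^ n"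
      using ex[of "(norm x + norm y) *\<^sub>R 1 :: real"] by auto
    have nx: "norm x < \<delta> * 2 ^ n" "norm y < \<delta> * 2 ^ n" "norm (x + y) < \<delta> * 2 ^ n"
      using n norm_triangle_ineq[of x y] norm_ge_zero[of x] norm_ge_zero[of y] by linarith+
    let ?x = "(1/2^n) *\<^sub>R x" and ?y = "(1/2^n) *\<^sub>R y"
    have m: "norm ?x < \<delta>" "norm ?y < \<delta>" "norm (?x + ?y) < \<delta>"
      using nx[THEN shrink] by (simp_all add: scaleR_right_distrib)
    \<comment> \<open>compare the midpoint of \<open>?x\<close> and \<open>?y\<close> with half of \<open>?x + ?y\<close>\<close>
    have "(1/2) *\<^sub>R F (?x + ?y) = (1/2) *\<^sub>R (F ?x + F ?y)"
      using half[OF m(3)] mid[OF m(1,2)] by (simp add: midpoint_def)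
    then have "F (?x + ?y) = F ?x + F ?y" by simp
    then show ?thesis
      using nx by (simp add: S[of _ n] G_def scaleR_right_distrib)
  qed
  have nS: "norm (S x) = norm x" for x
  proof -
    obtain n where n: "norm x < \<delta> * 2 ^ n" using ex by blast
    from iso[OF shrink[OF n]] show ?thesis using n by (simp add: S[of _ n] G_def)
  qed
  have "S x = F x" if "norm x < \<delta>" for x
    using S[of x 0] that by (simp add: G_def)
  then show ?thesis using additive_isometry_linear[of S] add nS by blast
qed

section \<open>Isometric homomorphisms near the unit\<close>

text \<open>Near \<open>1\<close> the map \<open>T\<close> is affine, \<open>T (1 + x) = 1 + S x\<close> with \<open>S\<close> linear and isometric. Expanding
\<open>T ((1 + s a) (1 + s b)) = T (1 + s a) T (1 + s b)\<close> for small real \<open>s > 0\<close> and comparing the terms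
with \<open>s\<^sup>2\<close> gives \<open>S (a b) = S a S b\<close>. As \<open>S\<close> is onto, \<open>S 1\<close> is a unit element and hence equals
\<open>1\<close>, so the affine map coincides with \<open>S\<close>.\<close>

lemma local_isometric_hom_is_algebra_iso:
  fixes T :: "'a::real_normed_algebra_1 \<Rightarrow> 'b::real_normed_algebra_1"
  assumes "r > 0" and A: "ball 1 r \<subseteq> A" and B: "ball 1 r \<subseteq> B"
    and T: "bij_betw T A B" and T1: "T 1 = 1"
    and mult: "\<And>x y. x \<in> A \<Longrightarrow> y \<in> A \<Longrightarrow> T (x * y) = T x * T y"
    and iso: "\<And>x y. x \<in> A \<Longrightarrow> y \<in> A \<Longrightarrow> norm (T x - T y) = norm (x - y)"
  obtains S where "isometric_real_algebra_iso S" "S 1 = 1" "\<And>x. norm (x - 1) < r / 2 \<Longrightarrow> S x = T x"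
proof -
  define \<delta> where "\<delta> = r / 2"
  have \<delta>: "\<delta> > 0" "\<delta> < r" using \<open>r > 0\<close> by (simp_all add: \<delta>_def)
  have inA: "1 + x \<in> A" if "norm x < \<delta>" for x
    using that A \<delta> by (auto simp: dist_norm)
  have "1 \<in> A" using inA[of 0] \<delta> by simp
  define F where "F x = T (1 + x) - 1" for x
  have F_iso: "norm (F x) = norm x" if "norm x < \<delta>" for x
    using iso[OF inA[OF that] \<open>1 \<in> A\<close>] by (simp add: F_def T1)
  have F_mid: "F (midpoint x y) = midpoint (F x) (F y)" if "norm x < \<delta>" "norm y < \<delta>" for x y
  proof -
    have tr: "midpoint (c + a) (c + b) = c + midpoint a b" for c a b :: "'c::real_vector"
    proof -
      have "(1/2) *\<^sub>R c + (1/2) *\<^sub>R c = c" by (simp flip: scaleR_left_distrib)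
      then show ?thesis
        unfolding midpoint_def by (simp add: scaleR_right_distrib algebra_simps)
    qed
    have "midpoint (1 + x) (1 + y) = 1 + midpoint x y" by (rule tr)
    moreover have "midpoint (a - 1) (b - 1) = midpoint a b - 1" for a b :: 'b
      using tr[of "-1" a b] by simp
    moreover have "T (midpoint (1 + x) (1 + y)) = midpoint (T (1 + x)) (T (1 + y))"
      by (rule local_isometry_midpoint[OF T iso A])
         (use B that T1 in \<open>auto simp: dist_norm \<delta>_def\<close>)
    ultimately show ?thesis by (simp add: F_def)
  qed
  have F0: "F 0 = 0" by (simp add: F_def T1)
  obtain S where lin: "linear S" and Sn: "\<And>x. norm (S x) = norm x" and SF: "\<And>x. norm x < \<delta> \<Longrightarrow> S x = F x"
    using midpoint_isometry_extends_linear[of \<delta> F, OF \<delta>(1) F0 F_mid F_iso] by blast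
  interpret S: linear S by (rule lin)
  have TS: "T (1 + x) = 1 + S x" if "norm x < \<delta>" for x
    using SF[OF that] by (simp add: F_def)
  have ex_small: "\<exists>s>0. s * c < \<delta>" for c
  proof -
    have "((\<lambda>s. s * c) \<longlongrightarrow> 0 * c) (at_right 0)" by (intro tendsto_intros)
    then have "eventually (\<lambda>s. s * c < \<delta>) (at_right 0)"
      using order_tendstoD(2)[of _ "0 * c" _ \<delta>] \<delta> by simp
    then have "eventually (\<lambda>s. s * c < \<delta> \<and> s > 0) (at_right 0)"
      by (intro eventually_conj) (simp_all add: eventually_at_right_less)
    then show ?thesis using eventually_happens by force
  qed
  have S_mult: "S (a * b) = S a * S b" for a b
  proof -
    obtain s0 where s0: "s0 > 0" "s0 * (norm a + norm b + norm (a * b)) < \<delta>"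
      using ex_small by blast
    \<comment> \<open>\<open>s \<le> 1\<close> makes the quadratic term at most \<open>s * norm (a * b)\<close>\<close>
    define s where "s = min s0 1"
    have s: "s > 0" "s \<le> s0" "s \<le> 1" using s0(1) by (auto simp: s_def)
    have "s * (norm a + norm b + norm (a * b)) \<le> s0 * (norm a + norm b + norm (a * b))"
      using s by (intro mult_right_mono) auto
    then have lt: "s * norm a + s * norm b + s * norm (a * b) < \<delta>"
      using s0(2) by (simp add: algebra_simps)
    have nn: "0 \<le> s * norm a" "0 \<le> s * norm b" "0 \<le> s * norm (a * b)" using s by auto
    have "s * s * norm (a * b) \<le> 1 * s * norm (a * b)"
      using s by (intro mult_right_mono) auto
    moreover have "norm (s *\<^sub>R a + s *\<^sub>R b + (s * s) *\<^sub>R (a * b))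
        \<le> s * norm a + s * norm b + s * s * norm (a * b)"
      using s norm_triangle_ineq[of "s *\<^sub>R a + s *\<^sub>R b" "(s * s) *\<^sub>R (a * b)"]
        norm_triangle_ineq[of "s *\<^sub>R a" "s *\<^sub>R b"] by simp
    ultimately have "norm (s *\<^sub>R a + s *\<^sub>R b + (s * s) *\<^sub>R (a * b)) < \<delta>"
      using lt by linarith
    moreover have na: "norm (s *\<^sub>R a) < \<delta>" "norm (s *\<^sub>R b) < \<delta>"
      using lt nn s(1) by (simp_all only: norm_scaleR abs_of_pos)
    moreover have "(1 + s *\<^sub>R a) * (1 + s *\<^sub>R b) = 1 + (s *\<^sub>R a + s *\<^sub>R b + (s * s) *\<^sub>R (a * b))"
      by (simp add: algebra_simps)
    ultimately have "1 + S (s *\<^sub>R a + s *\<^sub>R b + (s * s) *\<^sub>R (a * b)) = (1 + S (s *\<^sub>R a)) * (1 + S (s *\<^sub>R b))"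
      using mult[OF inA inA, of "s *\<^sub>R a" "s *\<^sub>R b"] TS by metis
    then have "(s * s) *\<^sub>R S (a * b) = (s * s) *\<^sub>R (S a * S b)"
      by (simp add: S.add S.scale algebra_simps)
    then show ?thesis using s by simp
  qed
  have "\<exists>x. y = S x" for y
  proof -
    obtain s where s: "s > 0" "s * norm y < \<delta>" using ex_small by blast
    then have "1 + s *\<^sub>R y \<in> B" using B \<delta> by (auto simp: dist_norm)
    then obtain x where x: "x \<in> A" "T x = 1 + s *\<^sub>R y"
      using T by (auto simp: bij_betw_def)
    have "norm (x - 1) < \<delta>"
      using iso[OF x(1) \<open>1 \<in> A\<close>] s by (simp add: T1 x(2))
    then have "S (x - 1) = s *\<^sub>R y" using TS[of "x - 1"] x(2) by simp
    then have "y = S ((1/s) *\<^sub>R (x - 1))" using s by (simp add: S.scale)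
    then show ?thesis by blast
  qed
  then have "surj S" by (auto simp: surj_def)
  have "inj S"
    using Sn by (simp add: S.inj_iff_eq_0) (metis norm_eq_zero)
  have S1: "S 1 = 1"
  proof -
    obtain e where "S e = 1" using \<open>surj S\<close> by (metis surjD)
    then show ?thesis using S_mult[of 1 e] by simp
  qed
  have "isometric_real_algebra_iso S"
    unfolding isometric_real_algebra_iso_def bij_def
    using lin S_mult Sn \<open>surj S\<close> \<open>inj S\<close> by (simp flip: S.diff)
  moreover have "S x = T x" if "norm (x - 1) < r / 2" for x
    using TS[of "x - 1"] that by (simp add: S.diff S1 \<delta>_def)
  ultimately show ?thesis using that S1 by blast
qed

section \<open>Elements of zero numerical range\<close>

lemma scaleC_zero_left: "0 *\<^sub>C (x::'a::complex_banach_algebra_1) = 0"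
  using scaleR_scaleC[of 0 x] by simp

lemma scaleC_diff_right: "c *\<^sub>C (x - y) = c *\<^sub>C x - c *\<^sub>C (y::'a::complex_banach_algebra_1)"
  using scaleC_add_right[of c "x - y" y] by simp

text \<open>A weak form of the fact that the unit is an extreme point of the unit ball of a complex Banach algebra.
All powers \<open>(1 + z w)^n\<close> with \<open>cmod z = s\<close> have norm at most \<open>1\<close>. By Cauchy's estimate the
coefficient \<open>n w\<close> of \<open>z\<close> in this polynomial satisfies \<open>n s (norm w) \<le> 1\<close>, for every \<open>n\<close>. The
coefficient is extracted by averaging over \<open>N\<close>-th roots of unity with \<open>N > n + 1\<close>.\<close>

lemma norm_one_plus_circle_le_one_imp_zero:
  fixes w :: "'a::complex_banach_algebra_1"
  assumes "s > 0" and le: "\<And>z. cmod z = s \<Longrightarrow> norm (1 + z *\<^sub>C w) \<le> 1"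
  shows "w = 0"
proof -
  have bound: "real n * (s * norm w) \<le> 1" for n
  proof -
    define N where "N = n + 2"
    have "n < N" by (simp add: N_def)
    define \<omega> where "\<omega> = cis (2 * pi / real N)"
    define u where "u m = \<omega> ^ m *\<^sub>C (1::'a)" for m
    have u: "u m * x = \<omega> ^ m *\<^sub>C x" for m x
      by (simp add: u_def mult_scaleC_left)
    have um: "u (l + m) = u l * u m" for l m
      unfolding u[of l "u m"] by (simp add: u_def scaleC_scaleC power_add)
    \<comment> \<open>\<open>\<omega>\<close> is a primitive \<open>N\<close>-th root of unity, and \<open>u m\<close> is the scalar \<open>\<omega> ^ m\<close> seen in the algebra.
      \<open>E k m\<close> is \<open>N\<close> times the sum of the coefficients of \<open>z ^ l\<close> in \<open>(1 + z s w) ^ k\<close> over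
      all \<open>l\<close> with \<open>N dvd l + m\<close>; the recursion in \<open>k\<close> replaces the binomial theorem.\<close>
    define E where "E k m = (\<Sum>j<N. u (j * m) * (1 + u j * (s *\<^sub>R w)) ^ k)" for k m
    have E_Suc: "E (Suc k) m = E k m + (s *\<^sub>R w) * E k (Suc m)" for k m
    proof -
      have "\<omega> ^ a *\<^sub>C ((1 + \<omega> ^ j *\<^sub>C v) * P) = \<omega> ^ a *\<^sub>C P + v * \<omega> ^ (j + a) *\<^sub>C P" for v P :: 'a and a j
        by (simp add: distrib_right scaleC_add_right mult_scaleC_left mult_scaleC_right scaleC_scaleC
            power_add mult.commute)
      then have "u (j * m) * (1 + u j * (s *\<^sub>R w)) ^ Suc k =
          u (j * m) * (1 + u j * (s *\<^sub>R w)) ^ k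
          + (s *\<^sub>R w) * (u (j * Suc m) * (1 + u j * (s *\<^sub>R w)) ^ k)" for j
        unfolding u power_Suc mult_Suc_right by blast
      then show ?thesis unfolding E_def sum_distrib_left sum.distrib[symmetric] by simp
    qed
    have \<omega>_N: "\<omega> ^ m = 1 \<longleftrightarrow> N dvd m" for m
    proof -
      have "\<omega> ^ m = exp (2 * of_real pi * \<i> * of_nat m / of_nat N)"
        by (simp add: \<omega>_def cis_conv_exp exp_of_nat_mult[symmetric] mult_ac)
      then show ?thesis
        using complex_root_unity_eq_1[of N m] by (simp add: N_def)
    qed
    have u_sum: "(\<Sum>j\<in>J. c j *\<^sub>C (1::'a)) = (\<Sum>j\<in>J. c j) *\<^sub>C 1" for c and J :: "nat set"
      by (induction J rule: infinite_finite_induct) (simp_all add: scaleC_zero_left scaleC_add_left)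
    have E_0: "E 0 m = 0" if "\<not> N dvd m" for m
    proof -
      have "(\<Sum>j<N. (\<omega> ^ m) ^ j) = 0"
        using that \<omega>_N[of m] \<omega>_N[of "m * N"] by (simp add: sum_gp_strict power_mult)
      then show ?thesis
        by (simp add: E_def u_def u_sum scaleC_zero_left mult.commute[of _ m] power_mult)
    qed
    have E_zero: "E k m = 0" if "\<And>l. l \<le> k \<Longrightarrow> \<not> N dvd m + l" for k m
      using that
    proof (induction k arbitrary: m)
      case 0
      then show ?case using E_0[of m] by simp
    next
      case (Suc k)
      have "\<not> N dvd m + l" "\<not> N dvd Suc m + l" if "l \<le> k" for l
        using Suc.prems[of l] Suc.prems[of "Suc l"] that by auto
      then show ?case using Suc.IH[of m] Suc.IH[of "Suc m"] by (simp add: E_Suc)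
    qed
    have E_N: "E k N = real N *\<^sub>R 1" if "k < N" for k
      using that
    proof (induction k)
      case 0
      have "\<omega> ^ (j * N) = 1" for j using \<omega>_N[of "j * N"] by simp
      then show ?case by (simp add: E_def u_def scaleC_one scaleR_conv_of_real)
    next
      case (Suc k)
      have "\<not> N dvd Suc N + l" if "l \<le> k" for l
      proof -
        have "Suc N + l = N + Suc l" by simp
        moreover have "\<not> N dvd Suc l" using that Suc.prems by (auto dest: dvd_imp_le)
        ultimately show ?thesis by (metis dvd_add_right_iff dvd_refl)
      qed
      then have "E k (Suc N) = 0" by (rule E_zero)
      then show ?case using Suc by (simp add: E_Suc)
    qed
    \<comment> \<open>as \<open>Suc n = N - 1\<close>, this is the linear coefficient \<open>k s w\<close>, times \<open>N\<close>\<close>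
    have E_val: "E k (Suc n) = (real k * real N * s) *\<^sub>R w" if "k < N" for k
      using that
    proof (induction k)
      case 0
      have "\<not> N dvd Suc n" by (auto simp: N_def dest: dvd_imp_le)
      then show ?case using E_0 by simp
    next
      case (Suc k)
      have "E k (Suc (Suc n)) = real N *\<^sub>R 1" using E_N[of k] Suc.prems by (simp add: N_def)
      then show ?case using Suc by (simp add: E_Suc algebra_simps)
    qed
    have "norm (E n (Suc n)) \<le> (\<Sum>j<N. 1)"
      unfolding E_def
    proof (rule sum_norm_le)
      fix j
      have "u j * (s *\<^sub>R w) = (\<omega> ^ j * of_real s) *\<^sub>C w"
        by (simp add: u scaleR_scaleC scaleC_scaleC)
      then have "norm (1 + u j * (s *\<^sub>R w)) \<le> 1"
        using le[of "\<omega> ^ j * of_real s"] \<open>s > 0\<close> by (simp add: norm_mult norm_power \<omega>_def)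
      then have "norm ((1 + u j * (s *\<^sub>R w)) ^ n) \<le> 1"
        using norm_power_ineq[of "1 + u j * (s *\<^sub>R w)" n] by (meson norm_ge_zero order_trans power_le_one)
      moreover have "norm (u (j * Suc n) * X) = norm X" for X
        unfolding u by (simp only: norm_scaleC norm_power) (simp add: \<omega>_def)
      ultimately show "norm (u (j * Suc n) * (1 + u j * (s *\<^sub>R w)) ^ n) \<le> 1" by simp
    qed
    moreover have "norm (E n (Suc n)) = real N * (real n * (s * norm w))"
      using E_val[of n] \<open>s > 0\<close> \<open>n < N\<close> by (simp add: abs_mult)
    ultimately have "real N * (real n * (s * norm w)) \<le> real N * 1" by simp
    then show ?thesis using \<open>n < N\<close> by (subst (asm) mult_le_cancel_left_pos) auto
  qed
  have "s * norm w \<le> 0"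
  proof (rule ccontr)
    assume "\<not> s * norm w \<le> 0"
    then obtain n where "1 < real n * (s * norm w)"
      using reals_Archimedean3[of "s * norm w"] by auto
    then show False using bound[of n] by simp
  qed
  then show ?thesis using \<open>s > 0\<close> by (simp add: mult_le_0_iff)
qed

section \<open>From a neighbourhood of the unit to the whole group\<close>

text \<open>A nonzero scalar \<open>z\<close> is the \<open>n\<close>-th power of \<open>exp (Ln z / n)\<close>, which is near \<open>1\<close> for large \<open>n\<close>.\<close>

lemma nonzero_scalar_in_of_ball_at_one:
  fixes H :: "'a::complex_banach_algebra_1 set"
  assumes "\<delta> > 0" and near: "\<And>x. norm (x - 1) < \<delta> \<Longrightarrow> x \<in> H"
    and mult: "\<And>x y. x \<in> H \<Longrightarrow> y \<in> H \<Longrightarrow> x * y \<in> H" and "z \<noteq> 0"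
  shows "z *\<^sub>C 1 \<in> H"
proof -
  have power: "(c *\<^sub>C (1::'a)) ^ n = c ^ n *\<^sub>C 1" for c n
    by (induction n) (simp_all add: scaleC_one mult_scaleC_left scaleC_scaleC)
  have "(\<lambda>n. Ln z / of_nat n) \<longlonglongrightarrow> 0"
    by (rule tendsto_divide_0[OF tendsto_const]) (simp add: tendsto_of_nat)
  then have "(\<lambda>n. exp (Ln z / of_nat n)) \<longlonglongrightarrow> 1"
    using tendsto_exp by fastforce
  then have "eventually (\<lambda>n. dist (exp (Ln z / of_nat n)) 1 < \<delta>) sequentially"
    using \<open>\<delta> > 0\<close> by (rule tendstoD)
  then have "eventually (\<lambda>n. n > 0 \<and> dist (exp (Ln z / of_nat n)) 1 < \<delta>) sequentially"
    by (intro eventually_conj eventually_gt_at_top)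
  then obtain n :: nat where n: "n > 0" "dist (exp (Ln z / of_nat n)) 1 < \<delta>"
    using eventually_happens'[OF sequentially_bot] by blast
  define c where "c = exp (Ln z / of_nat n)"
  have "c ^ n = z"
    using n(1) \<open>z \<noteq> 0\<close> by (simp add: c_def flip: exp_of_nat_mult)
  have "(c *\<^sub>C (1::'a)) - 1 = (c - 1) *\<^sub>C 1"
    using scaleC_add_left[of "c - 1" 1 "1::'a"] by (simp add: scaleC_one)
  then have "c *\<^sub>C 1 \<in> H"
    using n(2) by (intro near) (simp add: norm_scaleC c_def dist_norm)
  then have "(c *\<^sub>C 1) ^ k \<in> H" for k
    by (induction k) (use near[of 1] mult \<open>\<delta> > 0\<close> in auto)
  then show ?thesis using power \<open>c ^ n = z\<close> by metis
qed

text \<open>This is what carries the equality \<open>S = T\<close> over to elements \<open>g\<close> that are not products of elements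
near \<open>1\<close>. Write \<open>T g = S g'\<close>. For large scalars \<open>\<mu>\<close> the element \<open>g' - \<mu>\<close> is a scalar times an
element near \<open>1\<close>, so \<open>S\<close> and \<open>T\<close> agree there and
\<open>norm (g - (g' - \<mu>)) = norm (g' - (g' - \<mu>)) = cmod \<mu>\<close>. With \<open>z = 1 / \<mu>\<close> this reads
\<open>norm (1 + z (g - g')) = 1\<close>, on a whole circle of values of \<open>z\<close>, which forces \<open>g = g'\<close>.\<close>

lemma isometric_hom_determined_near_one:
  fixes S T :: "'a::complex_banach_algebra_1 \<Rightarrow> 'b::real_normed_algebra_1"
  assumes S: "isometric_real_algebra_iso S" and "\<delta> > 0"
    and near: "\<And>x. norm (x - 1) < \<delta> \<Longrightarrow> x \<in> A \<and> S x = T x"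
    and closed: "\<And>x y. x \<in> A \<Longrightarrow> y \<in> A \<Longrightarrow> x * y \<in> A"
    and mult: "\<And>x y. x \<in> A \<Longrightarrow> y \<in> A \<Longrightarrow> T (x * y) = T x * T y"
    and iso: "\<And>x y. x \<in> A \<Longrightarrow> y \<in> A \<Longrightarrow> norm (T x - T y) = norm (x - y)"
    and "g \<in> A"
  shows "S g = T g"
proof -
  have S_mult: "S (x * y) = S x * S y" and S_iso: "norm (S x - S y) = norm (x - y)" for x y
    using S by (auto simp: isometric_real_algebra_iso_def)
  obtain g' where g': "S g' = T g"
    using S by (metis isometric_real_algebra_iso_def bij_def surjD)
  define H where "H = {x \<in> A. S x = T x}"
  have H_mult: "x * y \<in> H" if "x \<in> H" "y \<in> H" for x y
    using that by (simp add: H_def closed mult S_mult)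
  \<comment> \<open>so that \<open>cmod z = s\<close> implies \<open>norm (z *\<^sub>C g') < \<delta>\<close>\<close>
  define s where "s = \<delta> / (norm g' + 1)"
  have "s > 0" using \<open>\<delta> > 0\<close> by (simp add: s_def add_nonneg_pos)
  have "norm (1 + z *\<^sub>C (g - g')) \<le> 1" if z: "cmod z = s" for z
  proof -
    have "z \<noteq> 0" using z \<open>s > 0\<close> by auto
    have "norm (z *\<^sub>C g') < \<delta>"
      using \<open>\<delta> > 0\<close> by (simp add: norm_scaleC z s_def field_simps add_pos_nonneg)
    then have near_z: "1 - z *\<^sub>C g' \<in> H" using near[of "1 - z *\<^sub>C g'"] by (simp add: H_def)
    \<comment> \<open>the element \<open>g' - \<mu>\<close> for \<open>\<mu> = 1 / z\<close>\<close>
    define h where "h = ((- inverse z) *\<^sub>C 1) * (1 - z *\<^sub>C g')"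
    have "h \<in> H" unfolding h_def
      using near \<open>z \<noteq> 0\<close> \<open>\<delta> > 0\<close>
      by (intro H_mult near_z nonzero_scalar_in_of_ball_at_one[of \<delta>]) (auto simp: H_def closed mult S_mult)
    have "z *\<^sub>C h = z *\<^sub>C g' - 1"
    proof -
      have "(-1) *\<^sub>C x = - x" for x :: 'a using scaleR_scaleC[of "-1" x] by simp
      then show ?thesis using \<open>z \<noteq> 0\<close> by (simp add: h_def mult_scaleC_left scaleC_scaleC)
    qed
    then have zh: "z *\<^sub>C (x - h) = 1 + z *\<^sub>C (x - g')" for x
      by (simp add: scaleC_diff_right)
    have "norm (g - h) = norm (T g - T h)"
      using \<open>h \<in> H\<close> \<open>g \<in> A\<close> by (simp add: H_def iso)
    also have "\<dots> = norm (g' - h)"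
      using \<open>h \<in> H\<close> S_iso[of g' h] by (simp add: H_def g')
    finally have "norm (z *\<^sub>C (g - h)) = norm (z *\<^sub>C (g' - h))"
      by (simp add: norm_scaleC)
    moreover have "z *\<^sub>C (0::'a) = 0" using scaleC_add_right[of z 0 "0::'a"] by simp
    ultimately show ?thesis by (simp add: zh)
  qed
  then have "g - g' = 0"
    using norm_one_plus_circle_le_one_imp_zero \<open>s > 0\<close> by blast
  then show ?thesis using g' by simp
qed

section \<open>Groups of invertible elements\<close>

lemma neumann_invertible:
  fixes x :: "'a::{real_normed_algebra_1,banach}"
  assumes "norm (x - 1) < 1"
  shows "\<exists>y. y * x = 1 \<and> x * y = 1"
proof -
  define q where "q = 1 - x"
  have "norm q < 1" using assms by (simp add: q_def norm_minus_commute)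
  then have s: "summable (\<lambda>n. q ^ n)" by (rule complete_algebra_summable_geometric)
  define y where "y = (\<Sum>n. q ^ n)"
  have t: "(\<Sum>n. q ^ Suc n) = y - 1"
    using suminf_split_head[OF s] by (simp add: y_def)
  have "q * y = y - 1"
    using suminf_mult[OF s, of q] t by (simp add: y_def)
  moreover have "y * q = y - 1"
    using suminf_mult2[OF s, of q] t by (simp add: y_def power_commutes)
  ultimately have "y * x = 1 \<and> x * y = 1"
    by (simp add: q_def algebra_simps)
  then show ?thesis by blast
qed

lemma open_in_units_contains_ball:
  fixes A :: "'a::{real_normed_algebra_1,banach} set"
  assumes "1 \<in> A" and "openin (top_of_set (carrier (invertible_group :: 'a monoid))) A"
  obtains r where "r > 0" "ball 1 r \<subseteq> A"
proof -
  obtain U where U: "open U" "A = carrier (invertible_group :: 'a monoid) \<inter> U"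
    using assms(2) by (auto simp: openin_open)
  then obtain e where e: "e > 0" "ball 1 e \<subseteq> U"
    using \<open>1 \<in> A\<close> by (meson IntD2 open_contains_ball)
  have "ball 1 (min e 1) \<subseteq> A"
    using e U(2) neumann_invertible
    by (auto simp: carrier_invertible_group dist_norm norm_minus_commute)
  then show ?thesis using that[of "min e 1"] e(1) by simp
qed

lemma algebra_iso_on_invertible_group:
  fixes S :: "'a::real_normed_algebra_1 \<Rightarrow> 'b::real_normed_algebra_1"
  assumes S: "isometric_real_algebra_iso S" and S1: "S 1 = 1"
  shows "isometric_group_iso invertible_group invertible_group S"
proof -
  have bij: "bij S" and mult: "\<And>x y. S (x * y) = S x * S y"
    and iso: "\<And>x y. norm (S x - S y) = norm (x - y)"
    using S by (auto simp: isometric_real_algebra_iso_def)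
  have eq: "S x = S y \<longleftrightarrow> x = y" for x y using bij by (metis bij_pointE)
  have unit: "S x \<in> carrier invertible_group \<longleftrightarrow> x \<in> carrier invertible_group" for x
  proof -
    have "(\<exists>y. y * S x = 1 \<and> S x * y = 1) \<longleftrightarrow> (\<exists>y. S y * S x = S 1 \<and> S x * S y = S 1)"
      using bij S1 by (metis bij_pointE)
    then show ?thesis by (simp add: carrier_invertible_group eq flip: mult)
  qed
  have "bij_betw S (carrier invertible_group) (carrier invertible_group)"
  proof (rule bij_betw_imageI)
    show "inj_on S (carrier invertible_group)" using bij by (meson bij_def inj_on_subset subset_UNIV)
    show "S ` carrier invertible_group = carrier invertible_group"
    proof
      show "S ` carrier invertible_group \<subseteq> carrier invertible_group" using unit by blast
      show "carrier invertible_group \<subseteq> S ` carrier invertible_group"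
      proof
        fix y assume "y \<in> carrier (invertible_group :: 'b monoid)"
        moreover obtain x where "y = S x" using bij by (metis bij_pointE)
        ultimately show "y \<in> S ` carrier invertible_group" using unit by blast
      qed
    qed
  qed
  then show ?thesis
    using unit iso mult
    by (auto simp: isometric_group_iso_def iso_def hom_def invertible_group_def units_of_def)
qed

theorem corollary4p1:
  fixes \<AA> :: "'a::complex_banach_algebra_1 set"
    and \<BB> :: "'b::complex_banach_algebra_1 set"
    and T :: "'a \<Rightarrow> 'b"
  assumes "subgroup \<AA> (invertible_group :: 'a monoid)"
    and "openin (top_of_set (carrier (invertible_group :: 'a monoid))) \<AA>"
    and "subgroup \<BB> (invertible_group :: 'b monoid)"
    and "openin (top_of_set (carrier (invertible_group :: 'b monoid))) \<BB>"
    and "isometric_group_iso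
          ((invertible_group :: 'a monoid)\<lparr>carrier := \<AA>\<rparr>)
          ((invertible_group :: 'b monoid)\<lparr>carrier := \<BB>\<rparr>) T"
  shows "(\<exists>S :: 'a \<Rightarrow> 'b. isometric_real_algebra_iso S \<and> (\<forall>a\<in>\<AA>. S a = T a)) \<and>
         (\<exists>h :: 'a \<Rightarrow> 'b. isometric_group_iso invertible_group invertible_group h)"
proof -
  have mult_eq: "x \<otimes>\<^bsub>invertible_group\<^esub> y = x * y" and one_eq: "\<one>\<^bsub>invertible_group\<^esub> = (1::'c)"
    for x y :: "'c::monoid_mult"
    by (simp_all add: invertible_group_def units_of_def)
  have one: "1 \<in> \<AA>" "1 \<in> \<BB>"
    using subgroup.one_closed[OF assms(1)] subgroup.one_closed[OF assms(3)] by (simp_all add: one_eq)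
  have closed: "x * y \<in> \<AA>" if "x \<in> \<AA>" "y \<in> \<AA>" for x y
    using subgroup.m_closed[OF assms(1) that] by (simp add: mult_eq)
  have bij: "bij_betw T \<AA> \<BB>"
    and mult: "\<And>x y. x \<in> \<AA> \<Longrightarrow> y \<in> \<AA> \<Longrightarrow> T (x * y) = T x * T y"
    and iso: "\<And>x y. x \<in> \<AA> \<Longrightarrow> y \<in> \<AA> \<Longrightarrow> norm (T x - T y) = norm (x - y)"
    using assms(5) by (auto simp: isometric_group_iso_def iso_def hom_def mult_eq)
  have "T 1 = 1"
  proof -
    have "T 1 \<in> \<BB>" using bij one by (auto simp: bij_betw_def)
    then obtain y where "y * T 1 = 1"
      using subgroup.subset[OF assms(3)] by (auto simp: carrier_invertible_group)
    moreover have "T 1 * T 1 = T 1" using mult[OF one(1) one(1)] by simp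
    ultimately show ?thesis by (metis mult.assoc mult_1_left)
  qed
  obtain r1 where r1: "r1 > 0" "ball 1 r1 \<subseteq> \<AA>" using open_in_units_contains_ball[OF one(1) assms(2)] .
  obtain r2 where r2: "r2 > 0" "ball 1 r2 \<subseteq> \<BB>" using open_in_units_contains_ball[OF one(2) assms(4)] .
  define r where "r = min r1 r2"
  have r: "r > 0" "ball 1 r \<subseteq> \<AA>" "ball 1 r \<subseteq> \<BB>" using r1 r2 by (auto simp: r_def)
  obtain S where S: "isometric_real_algebra_iso S" "S 1 = 1"
    and near: "\<And>x. norm (x - 1) < r / 2 \<Longrightarrow> S x = T x"
    using local_isometric_hom_is_algebra_iso[OF r bij \<open>T 1 = 1\<close> mult iso] by blast
  have "x \<in> \<AA> \<and> S x = T x" if "norm (x - 1) < r / 2" for x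
  proof -
    have "x \<in> ball 1 r" using that r(1) by (simp add: dist_norm norm_minus_commute)
    then show ?thesis using near[OF that] r(2) by blast
  qed
  then have "S a = T a" if "a \<in> \<AA>" for a
    using isometric_hom_determined_near_one[OF S(1) _ _ closed mult iso that, of "r / 2"] r(1) by simp
  then show ?thesis using S algebra_iso_on_invertible_group[OF S] by blast
qed

end
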